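(* Let $K$ be a finite simplicial complex of dimension $d$, $\mathcal{M}$ a smooth finite-dimensional manifold without boundary, and $F:\mathcal{M}\to\mathbb{R}^K$ a map all of whose values are filter functions. Let $B:=\mathrm{Dgm}\circ F:\mathcal{M}\to Bar^{d+1}$, where $\mathrm{Dgm}(f)=(\mathrm{Dgm}_0(f),\dots,\mathrm{Dgm}_d(f))$. Let $m_p,n_p$ ($0\le p\le d$), $\mathrm{Perm}$ and $Q=\prod_{p=0}^dQ_{m_p,n_p}$ be as described in the context. Then the map \[ \tilde B:\theta\in\mathcal{M}\longmapsto\mathrm{Perm}(F(\theta))\in\prod_{p=0}^d\mathbb{R}^{2m_p}\times\mathbb{R}^{n_p} \] is a global lift of $B$, i.e. $Q\circ\tilde B=B$ everywhere on $\mathcal{M}$. If moreover, for some $r\in\mathbb{N}$, $\mathcal{M}$ admits a Whitney stratification $\mathcal{S}_{\mathcal{M}}$ such that (i) $F$ is a weakly stratified map with respect to $\mathcal{S}_{\mathcal{M}}$ and $\Omega(\mathbb{R}^K)$, (ii) the restriction of $F$ to each stratum of $\mathcal{S}_{\mathcal{M}}$ is $C^r$, and (iii) for every $\theta\in\mathcal{M}$ and every stratum $\mathcal{M}'\in\mathcal{S}_{\mathcal{M}}$ incident to $\theta$, there is an open neighborhood $U$ of $\theta$ in $\mathcal{M}$ such that $F_{|\mathcal{M}'\cap U}$ extends to a $C^r$ map $U\to\mathbb{R}^K$, then over each stratum $\mathcal{M}'\in\mathcal{S}_{\mathcal{M}}$ one has $\tilde B=\mathrm{Perm}_{\mathcal{M}'}\circ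 F$ for some permutation matrix $\mathrm{Perm}_{\mathcal{M}'}$. Consequently, $B$ is $r$-differentiable along incident strata everywhere on $\mathcal{M}$, with directional derivatives given by those of $\tilde B$ (i.e. by the differentials at $\theta$ of local $C^r$ extensions, to a neighborhood of $\theta$ in $\mathcal{M}$, of the restriction of $\tilde B$ to the incident stratum).
   Context: Barcodes: a barcode is a multiset $D=D'\cup\Delta^\infty$, where $D'$ is a finite multiset of elements of $\mathbb{R}\times(\mathbb{R}\cup\{+\infty\})$ and $\Delta^\infty$ consists of the diagonal $\Delta=\{(b,b)\mid b\in\mathbb{R}\}$ with countably infinite multiplicity. $Bar$ is the set of barcodes. For $m,n\in\mathbb{N}$, $Q_{m,n}:\mathbb{R}^{2m}\times\mathbb{R}^n\to Bar$ is $Q_{m,n}(b_1,d_1,\dots,b_m,d_m,v_1,\dots,v_n)=\{(b_i,d_i)\}_{i=1}^m\cup\{(v_j,+\infty)\}_{j=1}^n\cup\Delta^\infty$. Filter functions: $f:K\to\mathbb{R}$ is a filter function if $f(\sigma)\le f(\sigma')$ whenever $\sigma\subseteq\sigma'$ are simplices of $K$. $\mathrm{Dgm}_p(f)\in Bar$ denotes the degree-$p$ barcode of $f$: with $K^t=\{\sigma\in K\mid f(\sigma)\le t\}$ and homology over a fixed field, the persistence module $(H_p(K^t))_{t\in\mathbb{R}}$ with maps induced by inclusions is isomorphic to a finite direct sum of interval modules $\bigoplus_{J\in\mathcal{J}}\mathbb{I}_J$, and $\mathrm{Dgm}_p(f)=\{(\inf J,\sup J)\}_{J\in\mathcal{J}}\cup\Delta^\infty$.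 Stratifications: a Whitney stratification of a smooth manifold $\mathcal{M}$ is a locally finite partition of $\mathcal{M}$ into connected smooth submanifolds (strata, not necessarily closed) such that for each stratum $\mathcal{M}'$ the set $\overline{\mathcal{M}'}\setminus\mathcal{M}'$ is a union of strata, and such that Whitney's condition (b) holds for every pair of strata. $\Omega(\mathbb{R}^K)$ is the Whitney stratification of $\mathbb{R}^K$ whose strata are the ordering equivalence classes, where $f,g\in\mathbb{R}^K$ are ordering equivalent if for all $\sigma,\sigma'\in K$, $f(\sigma)\le f(\sigma')\iff g(\sigma)\le g(\sigma')$. A map between stratified manifolds is weakly stratified if the pre-image of every stratum of the target is a union of strata of the source. A stratum $\mathcal{M}'$ is incident to $\theta$ if $\theta\in\overline{\mathcal{M}'}$. Differentiability along a stratum: for a stratum $\mathcal{M}'$ incident to $\theta$, a map $B:\mathcal{M}\to Bar$ is $r$-differentiable at $\theta$ along $\mathcal{M}'$ if there are an open neighborhood $U$ of $\theta$ in $\mathcal{M}$, integers $m,n$, and a $C^r$ map $\tilde B:U\to\mathbb{R}^{2m}\times\mathbb{R}^n$ such that $B=Q_{m,n}\circ\tilde B$ on $U\cap\mathcal{M}'$; then $d_\theta\tilde B$ is called a directional derivative of $B$ at $\theta$ along $\mathcal{M}'$. For maps to $Bar^{d+1}$ these notions are understood componentwise. The data $m_p,n_p,\mathrm{Perm}$: fix an ordering of the simplices of $K$, identifying $\mathbb{R}^K$ with $\mathbb{R}^{\#K}$. The integers $m_p,n_p$ ($0\le p\le d$) satisfy $\sum_{p=0}^d(2m_p+n_p)=\#K$,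 and $\mathrm{Perm}:\mathbb{R}^K\to\prod_{p=0}^d\mathbb{R}^{2m_p}\times\mathbb{R}^{n_p}\cong\mathbb{R}^{\#K}$ is a map whose restriction to each ordering equivalence class $S\in\Omega(\mathbb{R}^K)$ is (the restriction to $S$ of) a permutation matrix, and such that $Q(\mathrm{Perm}(f))=\mathrm{Dgm}(f)$ for every filter function $f$, where $Q:=\prod_{p=0}^dQ_{m_p,n_p}$. (Such data exist for every $K$.) *)

theory Defs
  imports
    "HOL-Analysis.Analysis"
    "HOL-Library.Multiset"
    "HOL-Library.FuncSet"
    "Jordan_Normal_Form.Matrix"
begin

hide_type (open) Finite_Cartesian_Product.vec

section \<open>Barcodes\<close>

text \<open>A multiset with possibly infinite multiplicities is represented by its multiplicity function.\<close>

type_synonym barcode = "real \<times> ereal \<Rightarrow> enat"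

definition with_diagonal :: "(real \<times> ereal) multiset \<Rightarrow> barcode" where
  "with_diagonal D = (\<lambda>(b, d). enat (count D (b, d)) + (if d = ereal b then \<infinity> else 0))"

definition Bar :: "barcode set" where
  "Bar = {with_diagonal D |D. \<forall>(b, d) \<in># D. d \<noteq> -\<infinity>}"

text \<open>The coordinates \<open>(b\<^sub>1, d\<^sub>1, \<dots>, b\<^sub>m, d\<^sub>m)\<close> form a vector of length \<open>2m\<close>, indexed from 0.\<close>

definition Q :: "nat \<Rightarrow> nat \<Rightarrow> real vec \<times> real vec \<Rightarrow> barcode" where
  "Q m n = (\<lambda>(x, v). with_diagonal
     (image_mset (\<lambda>i. (vec_index x (2 * i), ereal (vec_index x (2 * i + 1)))) (mset_set {..<m})
      + image_mset (\<lambda>j. (vec_index v j, \<infinity>)) (mset_set {..<n})))"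

lemma Q_in_Bar: "Q m n z \<in> Bar"
  by (cases z) (auto simp: Q_def Bar_def intro!: exI)


section \<open>Persistence modules\<close>

record ('k, 'x) vspace =
  vecs :: "'x set"
  vplus :: "'x \<Rightarrow> 'x \<Rightarrow> 'x"
  vscale :: "'k \<Rightarrow> 'x \<Rightarrow> 'x"

definition linear_iso :: "('k, 'x) vspace \<Rightarrow> ('k, 'y) vspace \<Rightarrow> ('x \<Rightarrow> 'y) \<Rightarrow> bool" where
  "linear_iso V W \<phi> \<longleftrightarrow> bij_betw \<phi> (vecs V) (vecs W)
     \<and> (\<forall>x\<in>vecs V. \<forall>y\<in>vecs V. \<phi> (vplus V x y) = vplus W (\<phi> x) (\<phi> y))
     \<and> (\<forall>a. \<forall>x\<in>vecs V. \<phi> (vscale V a x) = vscale W a (\<phi> x))"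

text \<open>\<open>trans_map M s t\<close> is only meaningful for \<open>s \<le> t\<close>.\<close>

record ('k, 'x) persistence_module =
  at_level :: "real \<Rightarrow> ('k, 'x) vspace"
  trans_map :: "real \<Rightarrow> real \<Rightarrow> 'x \<Rightarrow> 'x"

definition pm_isomorphic ::
  "('k, 'x) persistence_module \<Rightarrow> ('k, 'y) persistence_module \<Rightarrow> bool" where
  "pm_isomorphic M N \<longleftrightarrow> (\<exists>\<phi>.
     (\<forall>t. linear_iso (at_level M t) (at_level N t) (\<phi> t))
     \<and> (\<forall>s t. s \<le> t \<longrightarrow> (\<forall>x\<in>vecs (at_level M s).
            \<phi> t (trans_map M s t x) = trans_map N s t (\<phi> s x))))"

text \<open>The direct sum of the interval modules of the members of a list of intervals; the summand of
  \<open>J\<close> is the field at levels in \<open>J\<close>, with identity transition maps, and 0 elsewhere.\<close>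

definition interval_sum :: "real set list \<Rightarrow> ('k::field, nat \<Rightarrow> 'k) persistence_module" where
  "interval_sum Js = \<lparr>
     at_level = (\<lambda>t. \<lparr>vecs = {x. \<forall>i. x i \<noteq> 0 \<longrightarrow> i < length Js \<and> t \<in> Js ! i},
                     vplus = (\<lambda>x y i. x i + y i),
                     vscale = (\<lambda>a x i. a * x i)\<rparr>),
     trans_map = (\<lambda>s t x i. if t \<in> Js ! i then x i else 0)\<rparr>"


section \<open>Simplicial homology and barcodes of filter functions\<close>

definition simplicial_complex :: "'v set set \<Rightarrow> bool" where
  "simplicial_complex K \<longleftrightarrow> (\<forall>\<sigma>\<in>K. finite \<sigma> \<and> \<sigma> \<noteq> {} \<and> (\<forall>\<tau>. \<tau> \<subseteq> \<sigma> \<and> \<tau> \<noteq> {} \<longrightarrow> \<tau> \<in> K))"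

definition complex_dim :: "'v set set \<Rightarrow> nat" where
  "complex_dim K = Max ((\<lambda>\<sigma>. card \<sigma> - 1) ` K)"

text \<open>Oriented chains, without choosing orientations: a \<open>p\<close>-chain assigns coefficients to the tuples
  enumerating the \<open>p\<close>-simplices and changes sign under transpositions. The oriented simplex
  \<open>[v\<^sub>0, \<dots>, v\<^sub>p]\<close> is the chain that is the signature of \<open>\<pi>\<close> on \<open>[v\<^bsub>\<pi> 0\<^esub>, \<dots>, v\<^bsub>\<pi> p\<^esub>]\<close>. Its boundary as
  defined below takes the value \<open>(-1)^i\<close> at \<open>[v\<^sub>0, \<dots>, v\<^sub>p]\<close> with \<open>v\<^sub>i\<close> omitted.\<close>

definition chains :: "nat \<Rightarrow> 'v set set \<Rightarrow> ('v list \<Rightarrow> 'k::field) set" where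
  "chains p K = {c. (\<forall>xs. c xs \<noteq> 0 \<longrightarrow> length xs = p + 1 \<and> distinct xs \<and> set xs \<in> K)
     \<and> (\<forall>xs i j. i < length xs \<and> j < length xs \<and> i \<noteq> j \<longrightarrow>
           c (xs[i := xs ! j, j := xs ! i]) = - c xs)}"

text \<open>The value at the empty tuple is set to 0, since homology is not reduced.\<close>

definition bdry :: "'v set set \<Rightarrow> ('v list \<Rightarrow> 'k::field) \<Rightarrow> 'v list \<Rightarrow> 'k" where
  "bdry K c = (\<lambda>xs. if xs = [] then 0 else (\<Sum>v\<in>\<Union>K. c (v # xs)))"

definition cycles :: "nat \<Rightarrow> 'v set set \<Rightarrow> ('v list \<Rightarrow> 'k::field) set" where
  "cycles p K = {c \<in> chains p K. bdry K c = (\<lambda>_. 0)}"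

definition boundaries :: "nat \<Rightarrow> 'v set set \<Rightarrow> ('v list \<Rightarrow> 'k::field) set" where
  "boundaries p K = bdry K ` chains (p + 1) K"

definition add_boundaries ::
  "nat \<Rightarrow> 'v set set \<Rightarrow> ('v list \<Rightarrow> 'k::field) set \<Rightarrow> ('v list \<Rightarrow> 'k) set" where
  "add_boundaries p K A = {\<lambda>xs. a xs + b xs |a b. a \<in> A \<and> b \<in> boundaries p K}"

definition homology :: "nat \<Rightarrow> 'v set set \<Rightarrow> ('k::field, ('v list \<Rightarrow> 'k) set) vspace" where
  "homology p K = \<lparr>
     vecs = {add_boundaries p K {z} |z. z \<in> cycles p K},
     vplus = (\<lambda>A B. {\<lambda>xs. a xs + b xs |a b. a \<in> A \<and> b \<in> B}),
     vscale = (\<lambda>k A. add_boundaries p K ((\<lambda>a xs. k * a xs) ` A))\<rparr>"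

text \<open>\<open>\<real>\<^sup>K\<close> consists of the extensional functions on \<open>K\<close>.\<close>

definition fun_space :: "'v set set \<Rightarrow> ('v set \<Rightarrow> real) set" where
  "fun_space K = K \<rightarrow>\<^sub>E UNIV"

definition filter_function :: "'v set set \<Rightarrow> ('v set \<Rightarrow> real) \<Rightarrow> bool" where
  "filter_function K f \<longleftrightarrow> f \<in> fun_space K \<and> (\<forall>\<sigma>\<in>K. \<forall>\<sigma>'\<in>K. \<sigma> \<subseteq> \<sigma>' \<longrightarrow> f \<sigma> \<le> f \<sigma>')"

definition sublevel :: "'v set set \<Rightarrow> ('v set \<Rightarrow> real) \<Rightarrow> real \<Rightarrow> 'v set set" where
  "sublevel K f t = {\<sigma>\<in>K. f \<sigma> \<le> t}"

text \<open>The inclusion \<open>K\<^sup>s \<subseteq> K\<^sup>t\<close> sends the class of a cycle \<open>z\<close> to the class of \<open>z\<close>.\<close>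

definition sublevel_module ::
  "nat \<Rightarrow> 'v set set \<Rightarrow> ('v set \<Rightarrow> real) \<Rightarrow> ('k::field, ('v list \<Rightarrow> 'k) set) persistence_module" where
  "sublevel_module p K f = \<lparr>
     at_level = (\<lambda>t. homology p (sublevel K f t)),
     trans_map = (\<lambda>s t. add_boundaries p (sublevel K f t))\<rparr>"

text \<open>The intervals below are bounded below because \<open>K\<^sup>t\<close> is empty for small \<open>t\<close>, so the real
  infimum is the intended one. The barcode is unique by the Krull-Schmidt theorem.\<close>

definition Dgm :: "'k::field itself \<Rightarrow> 'v set set \<Rightarrow> ('v set \<Rightarrow> real) \<Rightarrow> nat \<Rightarrow> barcode" where
  "Dgm _ K f p = (THE D. \<exists>Js. (\<forall>J\<in>set Js. is_interval J \<and> J \<noteq> {})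
     \<and> pm_isomorphic (sublevel_module p K f :: ('k, ('v list \<Rightarrow> 'k) set) persistence_module)
          (interval_sum Js)
     \<and> D = with_diagonal (mset (map (\<lambda>J. (Inf J, Sup (ereal ` J))) Js)))"


section \<open>The ordering stratification and permutation data\<close>

definition ordering_equivalent ::
  "'v set set \<Rightarrow> ('v set \<Rightarrow> real) \<Rightarrow> ('v set \<Rightarrow> real) \<Rightarrow> bool" where
  "ordering_equivalent K f g \<longleftrightarrow> (\<forall>\<sigma>\<in>K. \<forall>\<sigma>'\<in>K. f \<sigma> \<le> f \<sigma>' \<longleftrightarrow> g \<sigma> \<le> g \<sigma>')"

definition Omega :: "'v set set \<Rightarrow> ('v set \<Rightarrow> real) set set" where
  "Omega K = {{g \<in> fun_space K. ordering_equivalent K f g} |f. f \<in> fun_space K}"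

definition permutation_matrix :: "nat \<Rightarrow> real mat \<Rightarrow> bool" where
  "permutation_matrix N P \<longleftrightarrow> P \<in> carrier_mat N N
     \<and> (\<forall>i<N. \<forall>j<N. P $$ (i, j) \<in> {0, 1})
     \<and> (\<forall>i<N. \<exists>!j. j < N \<and> P $$ (i, j) = 1)
     \<and> (\<forall>j<N. \<exists>!i. i < N \<and> P $$ (i, j) = 1)"

text \<open>The identification of \<open>\<real>\<^sup>K\<close> with \<open>\<real>\<^sup>N\<close>, \<open>N = card K\<close>, given by an enumeration \<open>ks\<close> of \<open>K\<close>.\<close>

definition coords :: "'v set list \<Rightarrow> ('v set \<Rightarrow> real) \<Rightarrow> real vec" where
  "coords ks f = vec_of_list (map f ks)"

text \<open>The identification of \<open>\<real>\<^sup>N\<close>, \<open>N = (\<Sum>p\<le>d. 2 * m p + n p)\<close>, with the product of the spaces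
  \<open>\<real>\<^bsup>2 * m p\<^esup> \<times> \<real>\<^bsup>n p\<^esup>\<close> by consecutive blocks: \<open>block m n p x\<close> is the component of \<open>x\<close> of index \<open>p\<close>.\<close>

definition block :: "(nat \<Rightarrow> nat) \<Rightarrow> (nat \<Rightarrow> nat) \<Rightarrow> nat \<Rightarrow> real vec \<Rightarrow> real vec \<times> real vec" where
  "block m n p x = (let k = (\<Sum>q<p. 2 * m q + n q) in
     (vec (2 * m p) (\<lambda>i. vec_index x (k + i)),
      vec (n p) (\<lambda>j. vec_index x (k + 2 * m p + j))))"

definition permutation_data ::
  "'k::field itself \<Rightarrow> 'v set set \<Rightarrow> 'v set list \<Rightarrow> nat \<Rightarrow> (nat \<Rightarrow> nat) \<Rightarrow> (nat \<Rightarrow> nat)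
   \<Rightarrow> (('v set \<Rightarrow> real) \<Rightarrow> real vec) \<Rightarrow> bool" where
  "permutation_data k K ks d m n Perm \<longleftrightarrow>
     (\<Sum>p\<le>d. 2 * m p + n p) = card K
     \<and> (\<forall>S\<in>Omega K. \<exists>P. permutation_matrix (card K) P \<and> (\<forall>f\<in>S. Perm f = P *\<^sub>v coords ks f))
     \<and> (\<forall>f. filter_function K f \<longrightarrow>
          (\<forall>p\<le>d. Q (m p) (n p) (block m n p (Perm f)) = Dgm k K f p))"


section \<open>Smooth manifolds\<close>

text \<open>\<open>Ck_on r L W f\<close> states that \<open>f\<close> is of class \<open>C\<^sup>r\<close> on \<open>W\<close>, where \<open>W\<close> is relatively open in the
  linear subspace \<open>L\<close>. Derivatives within \<open>W\<close> are then determined on \<open>L\<close>, and being \<open>C\<^sup>r\<^sup>+\<^sup>1\<close> amounts to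
  being differentiable with all directional derivatives of class \<open>C\<^sup>r\<close>.\<close>

primrec Ck_on :: "nat \<Rightarrow> 'e::euclidean_space set \<Rightarrow> 'e set \<Rightarrow> ('e \<Rightarrow> 'f::real_normed_vector) \<Rightarrow> bool" where
  "Ck_on 0 L W f = continuous_on W f"
| "Ck_on (Suc r) L W f = (\<exists>f'. (\<forall>x\<in>W. (f has_derivative f' x) (at x within W))
     \<and> (\<forall>v\<in>L. Ck_on r L W (\<lambda>x. f' x v)))"

definition smooth_on :: "'e::euclidean_space set \<Rightarrow> 'e set \<Rightarrow> ('e \<Rightarrow> 'f::real_normed_vector) \<Rightarrow> bool" where
  "smooth_on L W f \<longleftrightarrow> (\<forall>r. Ck_on r L W f)"

type_synonym ('a, 'e) chart = "'a set \<times> ('a \<Rightarrow> 'e)"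

text \<open>The model space is a linear subspace of a Euclidean space, so that dimension 0 is included
  (the class \<open>euclidean_space\<close> only contains spaces of positive dimension).\<close>

record ('a, 'e) manifold =
  mtop :: "'a topology"
  model :: "'e set"
  atlas :: "('a, 'e) chart set"

definition is_chart :: "('a, 'e::euclidean_space) manifold \<Rightarrow> ('a, 'e) chart \<Rightarrow> bool" where
  "is_chart M = (\<lambda>(U, \<phi>). openin (mtop M) U \<and> openin (top_of_set (model M)) (\<phi> ` U)
     \<and> homeomorphic_map (subtopology (mtop M) U) (top_of_set (\<phi> ` U)) \<phi>)"

definition smooth_transition ::
  "('a, 'e::euclidean_space) manifold \<Rightarrow> ('a, 'e) chart \<Rightarrow> ('a, 'e) chart \<Rightarrow> bool" where
  "smooth_transition M = (\<lambda>(U, \<phi>) (V, \<psi>).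
     smooth_on (model M) (\<phi> ` (U \<inter> V)) (\<psi> \<circ> inv_into U \<phi>))"

definition smooth_manifold :: "('a, 'e::euclidean_space) manifold \<Rightarrow> bool" where
  "smooth_manifold M \<longleftrightarrow> subspace (model M)
     \<and> Hausdorff_space (mtop M)
     \<and> (\<exists>\<B>. countable \<B> \<and> (\<forall>B\<in>\<B>. openin (mtop M) B)
            \<and> (\<forall>U x. openin (mtop M) U \<and> x \<in> U \<longrightarrow> (\<exists>B\<in>\<B>. x \<in> B \<and> B \<subseteq> U)))
     \<and> (\<Union>(U, \<phi>)\<in>atlas M. U) = topspace (mtop M)
     \<and> (\<forall>c\<in>atlas M. is_chart M c)
     \<and> (\<forall>c\<in>atlas M. \<forall>c'\<in>atlas M. smooth_transition M c c')"

definition smooth_charts :: "('a, 'e::euclidean_space) manifold \<Rightarrow> ('a, 'e) chart set" where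
  "smooth_charts M = {c. is_chart M c
     \<and> (\<forall>c'\<in>atlas M. smooth_transition M c c' \<and> smooth_transition M c' c)}"

definition Ck_map ::
  "('a, 'e::euclidean_space) manifold \<Rightarrow> nat \<Rightarrow> 'a set \<Rightarrow> ('a \<Rightarrow> real) \<Rightarrow> bool" where
  "Ck_map M r U g \<longleftrightarrow> (\<forall>(V, \<phi>)\<in>smooth_charts M.
     Ck_on r (model M) (\<phi> ` (U \<inter> V)) (g \<circ> inv_into V \<phi>))"

definition slice_chart ::
  "('a, 'e::euclidean_space) manifold \<Rightarrow> 'a set \<Rightarrow> 'e set \<Rightarrow> ('a, 'e) chart \<Rightarrow> bool" where
  "slice_chart M S L = (\<lambda>(U, \<phi>). subspace L \<and> L \<subseteq> model M \<and> (U, \<phi>) \<in> smooth_charts M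
     \<and> \<phi> ` (U \<inter> S) = \<phi> ` U \<inter> L)"

definition submanifold :: "('a, 'e::euclidean_space) manifold \<Rightarrow> 'a set \<Rightarrow> bool" where
  "submanifold M S \<longleftrightarrow> S \<subseteq> topspace (mtop M)
     \<and> (\<exists>k. \<forall>x\<in>S. \<exists>L U \<phi>. dim L = k \<and> x \<in> U \<and> slice_chart M S L (U, \<phi>))"

text \<open>The restrictions of slice charts to \<open>S\<close> are the charts of the submanifold \<open>S\<close>.\<close>

definition Ck_on_submanifold ::
  "('a, 'e::euclidean_space) manifold \<Rightarrow> nat \<Rightarrow> 'a set \<Rightarrow> ('a \<Rightarrow> real) \<Rightarrow> bool" where
  "Ck_on_submanifold M r S g \<longleftrightarrow> (\<forall>L U \<phi>. slice_chart M S L (U, \<phi>) \<longrightarrow>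
     Ck_on r L (\<phi> ` (U \<inter> S)) (g \<circ> inv_into U \<phi>))"

definition charts_at :: "('a, 'e::euclidean_space) manifold \<Rightarrow> 'a \<Rightarrow> ('a, 'e) chart set" where
  "charts_at M \<theta> = {(U, \<phi>) \<in> smooth_charts M. \<theta> \<in> U}"

text \<open>A tangent vector is given by its coordinates in every chart, which transform under the
  differentials of the transition maps.\<close>

definition tangent_space ::
  "('a, 'e::euclidean_space) manifold \<Rightarrow> 'a \<Rightarrow> (('a, 'e) chart \<Rightarrow> 'e) set" where
  "tangent_space M \<theta> = {v.
     (\<forall>c. c \<notin> charts_at M \<theta> \<longrightarrow> v c = 0) \<and> (\<forall>c\<in>charts_at M \<theta>. v c \<in> model M)
     \<and> (\<forall>(U, \<phi>)\<in>charts_at M \<theta>. \<forall>(V, \<psi>)\<in>charts_at M \<theta>.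
          \<exists>A. ((\<psi> \<circ> inv_into U \<phi>) has_derivative A) (at (\<phi> \<theta>) within \<phi> ` (U \<inter> V))
              \<and> v (V, \<psi>) = A (v (U, \<phi>)))}"

definition has_differential ::
  "('a, 'e::euclidean_space) manifold \<Rightarrow> ('a \<Rightarrow> real) \<Rightarrow> 'a set \<Rightarrow> 'a
   \<Rightarrow> ((('a, 'e) chart \<Rightarrow> 'e) \<Rightarrow> real) \<Rightarrow> bool" where
  "has_differential M g U \<theta> D \<longleftrightarrow> (\<forall>(V, \<phi>)\<in>charts_at M \<theta>.
     \<exists>A. ((g \<circ> inv_into V \<phi>) has_derivative A) (at (\<phi> \<theta>) within \<phi> ` (U \<inter> V))
         \<and> (\<forall>v\<in>tangent_space M \<theta>. D v = A (v (V, \<phi>))))"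


section \<open>Whitney stratifications\<close>

text \<open>Velocities of smooth curves: the tangent space at \<open>x\<close> if \<open>W\<close> is a smooth submanifold of an
  open subset of a linear subspace.\<close>

definition tangent_vectors :: "'e::euclidean_space set \<Rightarrow> 'e \<Rightarrow> 'e set" where
  "tangent_vectors W x = {v. \<exists>\<gamma> \<epsilon>. 0 < \<epsilon> \<and> smooth_on UNIV {-\<epsilon><..<\<epsilon>} \<gamma> \<and> \<gamma> ` {-\<epsilon><..<\<epsilon>} \<subseteq> W
     \<and> \<gamma> (0::real) = x \<and> (\<gamma> has_vector_derivative v) (at 0)}"

text \<open>Convergence in the Grassmannian, expressed by the gap metric: the Hausdorff distance of the
  closed unit balls tends to 0.\<close>

definition subspaces_tendsto :: "(nat \<Rightarrow> 'e::euclidean_space set) \<Rightarrow> 'e set \<Rightarrow> bool" where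
  "subspaces_tendsto T \<tau> \<longleftrightarrow> (\<forall>e>0. \<forall>\<^sub>F i in sequentially.
     (\<forall>v \<in> T i \<inter> cball 0 1. infdist v (\<tau> \<inter> cball 0 1) \<le> e)
     \<and> (\<forall>v \<in> \<tau> \<inter> cball 0 1. infdist v (T i \<inter> cball 0 1) \<le> e))"

definition whitney_b :: "('a, 'e::euclidean_space) manifold \<Rightarrow> 'a set \<Rightarrow> 'a set \<Rightarrow> bool" where
  "whitney_b M X Y \<longleftrightarrow> (\<forall>(U, \<phi>)\<in>smooth_charts M. \<forall>y0\<in>Y \<inter> U. \<forall>x y \<tau> l.
     (\<forall>i. x i \<in> X \<inter> U \<and> y i \<in> Y \<inter> U \<and> x i \<noteq> y i)
     \<and> (\<lambda>i. \<phi> (x i)) \<longlonglongrightarrow> \<phi> y0 \<and> (\<lambda>i. \<phi> (y i)) \<longlonglongrightarrow> \<phi> y0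
     \<and> subspace \<tau> \<and> subspaces_tendsto (\<lambda>i. tangent_vectors (\<phi> ` (X \<inter> U)) (\<phi> (x i))) \<tau>
     \<and> subspace l \<and> subspaces_tendsto (\<lambda>i. span {\<phi> (x i) - \<phi> (y i)}) l
     \<longrightarrow> l \<subseteq> \<tau>)"

definition whitney_stratification ::
  "('a, 'e::euclidean_space) manifold \<Rightarrow> 'a set set \<Rightarrow> bool" where
  "whitney_stratification M \<S> \<longleftrightarrow>
     partition_on (topspace (mtop M)) \<S>
     \<and> locally_finite_in (mtop M) \<S>
     \<and> (\<forall>S\<in>\<S>. connectedin (mtop M) S \<and> submanifold M S)
     \<and> (\<forall>S\<in>\<S>. \<exists>\<T>\<subseteq>\<S>. mtop M closure_of S - S = \<Union>\<T>)
     \<and> (\<forall>S\<in>\<S>. \<forall>T\<in>\<S>. whitney_b M S T)"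

definition weakly_stratified :: "'a set \<Rightarrow> 'a set set \<Rightarrow> 'b set set \<Rightarrow> ('a \<Rightarrow> 'b) \<Rightarrow> bool" where
  "weakly_stratified A \<S> \<T> F \<longleftrightarrow> (\<forall>T\<in>\<T>. \<exists>\<S>'\<subseteq>\<S>. F -` T \<inter> A = \<Union>\<S>')"

definition incident :: "('a, 'e::euclidean_space) manifold \<Rightarrow> 'a set \<Rightarrow> 'a \<Rightarrow> bool" where
  "incident M S \<theta> \<longleftrightarrow> \<theta> \<in> mtop M closure_of S"


section \<open>Differentiability of barcode valued maps\<close>

text \<open>Maps into \<open>\<real>\<^sup>2\<^sup>m \<times> \<real>\<^sup>n\<close> are of class \<open>C\<^sup>r\<close>, or have a differential, componentwise.\<close>

definition Ck_pair ::
  "('a, 'e::euclidean_space) manifold \<Rightarrow> nat \<Rightarrow> 'a set \<Rightarrow> nat \<Rightarrow> nat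
   \<Rightarrow> ('a \<Rightarrow> real vec \<times> real vec) \<Rightarrow> bool" where
  "Ck_pair M r U m n G \<longleftrightarrow> G ` U \<subseteq> carrier_vec (2 * m) \<times> carrier_vec n
     \<and> (\<forall>i<2 * m. Ck_map M r U (\<lambda>x. vec_index (fst (G x)) i))
     \<and> (\<forall>j<n. Ck_map M r U (\<lambda>x. vec_index (snd (G x)) j))"

definition has_differential_pair ::
  "('a, 'e::euclidean_space) manifold \<Rightarrow> nat \<Rightarrow> nat \<Rightarrow> ('a \<Rightarrow> real vec \<times> real vec)
   \<Rightarrow> 'a set \<Rightarrow> 'a \<Rightarrow> ((('a, 'e) chart \<Rightarrow> 'e) \<Rightarrow> real vec \<times> real vec) \<Rightarrow> bool" where
  "has_differential_pair M m n G U \<theta> D \<longleftrightarrow>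
     D ` tangent_space M \<theta> \<subseteq> carrier_vec (2 * m) \<times> carrier_vec n
     \<and> (\<forall>i<2 * m. has_differential M (\<lambda>x. vec_index (fst (G x)) i) U \<theta> (\<lambda>v. vec_index (fst (D v)) i))
     \<and> (\<forall>j<n. has_differential M (\<lambda>x. vec_index (snd (G x)) j) U \<theta> (\<lambda>v. vec_index (snd (D v)) j))"

definition local_lift_along ::
  "('a, 'e::euclidean_space) manifold \<Rightarrow> nat \<Rightarrow> ('a \<Rightarrow> barcode) \<Rightarrow> 'a \<Rightarrow> 'a set
   \<Rightarrow> 'a set \<Rightarrow> nat \<Rightarrow> nat \<Rightarrow> ('a \<Rightarrow> real vec \<times> real vec) \<Rightarrow> bool" where
  "local_lift_along M r B \<theta> S U m n G \<longleftrightarrow> openin (mtop M) U \<and> \<theta> \<in> U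
     \<and> Ck_pair M r U m n G \<and> (\<forall>x\<in>U \<inter> S. B x = Q m n (G x))"

definition differentiable_along ::
  "('a, 'e::euclidean_space) manifold \<Rightarrow> nat \<Rightarrow> ('a \<Rightarrow> barcode) \<Rightarrow> 'a \<Rightarrow> 'a set \<Rightarrow> bool" where
  "differentiable_along M r B \<theta> S \<longleftrightarrow> (\<exists>U m n G. local_lift_along M r B \<theta> S U m n G)"

definition directional_derivative ::
  "('a, 'e::euclidean_space) manifold \<Rightarrow> nat \<Rightarrow> ('a \<Rightarrow> barcode) \<Rightarrow> 'a \<Rightarrow> 'a set \<Rightarrow> nat \<Rightarrow> nat
   \<Rightarrow> ((('a, 'e) chart \<Rightarrow> 'e) \<Rightarrow> real vec \<times> real vec) \<Rightarrow> bool" where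
  "directional_derivative M r B \<theta> S m n D \<longleftrightarrow>
     (\<exists>U G. local_lift_along M r B \<theta> S U m n G \<and> has_differential_pair M m n G U \<theta> D)"

text \<open>\<open>G\<close> is a \<open>C\<^sup>r\<close> map from the open neighbourhood \<open>U\<close> of \<open>\<theta>\<close> to \<open>\<real>\<^sup>N\<close> extending the
  restriction of \<open>H\<close> to \<open>S \<inter> U\<close>.\<close>

definition local_extension ::
  "('a, 'e::euclidean_space) manifold \<Rightarrow> nat \<Rightarrow> nat \<Rightarrow> ('a \<Rightarrow> real vec) \<Rightarrow> 'a set \<Rightarrow> 'a
   \<Rightarrow> 'a set \<Rightarrow> ('a \<Rightarrow> real vec) \<Rightarrow> bool" where
  "local_extension M r N H S \<theta> U G \<longleftrightarrow> openin (mtop M) U \<and> \<theta> \<in> U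
     \<and> G ` U \<subseteq> carrier_vec N \<and> (\<forall>i<N. Ck_map M r U (\<lambda>x. vec_index (G x) i))
     \<and> (\<forall>x\<in>S \<inter> U. G x = H x)"

end

theory Submission
  imports Defs
begin

text \<open>
  The lift property is pointwise: \<open>Q\<close> composed with \<open>Perm\<close> is the barcode on filter functions, and
  every value of \<open>F\<close> is one.

  For the rest, the point is that \<open>Perm\<close> is a single permutation matrix on each ordering class. A
  weakly stratified \<open>F\<close> cannot split a stratum between two classes (\<open>stratum_into_ordering_class\<close>),
  so over a stratum every coordinate of \<open>Perm \<circ> F\<close> is one fixed coordinate of \<open>F\<close>
  (\<open>permutation_matrix_selects\<close>). Local \<open>C\<^sup>r\<close> extensions of \<open>F\<close> along an incident stratum therefore
  become local \<open>C\<^sup>r\<close> extensions of the lift just by permuting coordinates. Cutting such an extension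
  into blocks and applying \<open>Q\<close> recovers the barcodes on the stratum, which is differentiability
  along the stratum (\<open>local_extension_imp_local_lift\<close>).

  The analytic content is that a \<open>C\<^sup>r\<close> function with \<open>r \<ge> 1\<close> has a differential as a function of
  tangent vectors, which are families of coordinate vectors indexed by the charts
  (\<open>Ck_map_imp_has_differential\<close>). The derivative in one chart is a candidate. By the chain rule it
  agrees with the derivatives in all other charts, up to the ambiguity of derivatives within a
  subset; as chart images are open in the model space, there is no ambiguity on the vectors of the
  model space.
\<close>

section \<open>Permutation matrices and ordering classes\<close>

lemma permutation_matrix_selects:
  assumes "permutation_matrix N P"
  obtains \<pi> where "\<And>i. i < N \<Longrightarrow> \<pi> i < N"
    and "\<And>x i. x \<in> carrier_vec N \<Longrightarrow> i < N \<Longrightarrow> vec_index (P *\<^sub>v x) i = vec_index x (\<pi> i)"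
proof -
  have P: "P \<in> carrier_mat N N" and entries: "\<And>i j. i < N \<Longrightarrow> j < N \<Longrightarrow> P $$ (i, j) \<in> {0, 1}"
    and rows: "\<And>i. i < N \<Longrightarrow> \<exists>!j. j < N \<and> P $$ (i, j) = 1"
    using assms by (auto simp: permutation_matrix_def)
  define \<pi> where "\<pi> i = (THE j. j < N \<and> P $$ (i, j) = 1)" for i
  have \<pi>: "\<pi> i < N" "P $$ (i, \<pi> i) = 1" if "i < N" for i
    using theI'[OF rows[OF that]] by (auto simp: \<pi>_def)
  have entry: "P $$ (i, j) = (if j = \<pi> i then 1 else 0)" if "i < N" "j < N" for i j
    using entries[OF that] rows[OF that(1)] \<pi>[OF that(1)] that by auto
  have "vec_index (P *\<^sub>v x) i = vec_index x (\<pi> i)" if x: "x \<in> carrier_vec N" and i: "i < N" for x i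
  proof -
    have "vec_index (P *\<^sub>v x) i = (\<Sum>j<N. P $$ (i, j) * vec_index x j)"
      using P x i by (auto simp: scalar_prod_def atLeast0LessThan)
    also have "\<dots> = (\<Sum>j<N. if j = \<pi> i then vec_index x j else 0)"
      using entry[OF i] by (intro sum.cong) auto
    also have "\<dots> = vec_index x (\<pi> i)"
      using \<pi>(1)[OF i] by simp
    finally show ?thesis .
  qed
  with \<pi>(1) show ?thesis by (rule that)
qed

text \<open>The class of the value of \<open>F\<close> at one point of the stratum has a union of strata as its
  preimage, and this union contains the whole stratum because strata are disjoint.\<close>

lemma stratum_into_ordering_class:
  assumes part: "partition_on A \<S>" and F: "\<And>\<theta>. \<theta> \<in> A \<Longrightarrow> F \<theta> \<in> fun_space K"
    and weak: "weakly_stratified A \<S> (Omega K) F" and S: "S \<in> \<S>"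
  obtains T where "T \<in> Omega K" and "F ` S \<subseteq> T"
proof -
  have "S \<noteq> {}" "S \<subseteq> A"
    using part S by (auto simp: partition_on_def)
  then obtain \<theta> where \<theta>: "\<theta> \<in> S" "\<theta> \<in> A" by auto
  define T where "T = {g \<in> fun_space K. ordering_equivalent K (F \<theta>) g}"
  have T: "T \<in> Omega K" and "F \<theta> \<in> T"
    using F[OF \<theta>(2)] by (auto simp: T_def Omega_def ordering_equivalent_def)
  obtain \<T> where \<T>: "\<T> \<subseteq> \<S>" "F -` T \<inter> A = \<Union>\<T>"
    using weak T by (auto simp: weakly_stratified_def)
  have "\<theta> \<in> \<Union>\<T>"
    using \<T>(2) \<theta>(2) \<open>F \<theta> \<in> T\<close> by blast
  then obtain S' where "S' \<in> \<T>" "\<theta> \<in> S'" by blast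
  moreover have "S' = S"
    using partition_onD2[OF part] S \<T>(1) calculation \<theta>(1) by (auto simp: disjoint_def)
  ultimately have "F ` S \<subseteq> T"
    using \<T>(2) by blast
  with T show ?thesis by (rule that)
qed

section \<open>Differentials of continuously differentiable functions\<close>

text \<open>Restricted to a line through the point in a direction of the subspace, the function is defined
  on an open set of parameters, where derivatives are unique.\<close>

lemma has_derivative_within_unique_on_subspace:
  fixes f :: "'e::euclidean_space \<Rightarrow> 'f::real_normed_vector"
  assumes L: "subspace L" and W: "openin (top_of_set L) W" and x: "x \<in> W" and v: "v \<in> L"
    and A: "(f has_derivative A) (at x within W)" and B: "(f has_derivative B) (at x within W)"
  shows "A v = B v"
proof -
  have "x \<in> L"
    using W x openin_imp_subset by blast
  define line where "line t = x + t *\<^sub>R v" for t :: real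
  have line_L: "line t \<in> L" for t
    using L \<open>x \<in> L\<close> v by (auto simp: line_def intro: subspace_add subspace_scale)
  obtain O' where O': "open O'" "W = L \<inter> O'"
    using W by (auto simp: openin_open)
  define T where "T = line -` O'"
  have "continuous_on UNIV line"
    unfolding line_def by (intro continuous_intros)
  then have "open T"
    using O'(1) unfolding T_def by (rule open_vimage[rotated])
  have "0 \<in> T" and line0: "line 0 = x"
    using x O'(2) by (auto simp: T_def line_def)
  have "line ` T \<subseteq> W"
    using O'(2) line_L by (auto simp: T_def)
  have line_deriv: "(line has_derivative (\<lambda>t. t *\<^sub>R v)) (at 0 within T)"
    unfolding line_def by (auto intro!: derivative_eq_intros)
  have along: "((\<lambda>t. f (line t)) has_derivative (\<lambda>t. C (t *\<^sub>R v))) (at 0)"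
    if "(f has_derivative C) (at x within W)" for C
  proof -
    have "(f has_derivative C) (at (line 0) within line ` T)"
      using that \<open>line ` T \<subseteq> W\<close> line0 by (auto intro: has_derivative_subset)
    from diff_chain_within[OF line_deriv this] show ?thesis
      using at_within_open[OF \<open>0 \<in> T\<close> \<open>open T\<close>] by (simp add: o_def)
  qed
  have "(\<lambda>t. A (t *\<^sub>R v)) = (\<lambda>t. B (t *\<^sub>R v))"
    using along[OF A] along[OF B] by (rule has_derivative_unique)
  then show ?thesis
    by (metis scaleR_one)
qed

lemma is_chart_open_image:
  assumes "is_chart M (V, \<phi>)" and "openin (mtop M) U" and "U \<subseteq> V"
  shows "openin (top_of_set (model M)) (\<phi> ` U)"
proof -
  have V: "openin (top_of_set (model M)) (\<phi> ` V)"
    and hom: "homeomorphic_map (subtopology (mtop M) V) (top_of_set (\<phi> ` V)) \<phi>"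
    using assms(1) by (auto simp: is_chart_def)
  have "openin (subtopology (mtop M) V) U"
    using assms(2,3) by (auto simp: openin_subtopology)
  then have "openin (top_of_set (\<phi> ` V)) (\<phi> ` U)"
    using homeomorphic_imp_open_map[OF hom] by (auto simp: open_map_def)
  then show ?thesis
    using V by (rule openin_trans)
qed

lemma is_chart_inj_on:
  assumes "is_chart M (V, \<phi>)"
  shows "inj_on \<phi> V"
proof -
  have "V \<subseteq> topspace (mtop M)"
    using assms by (auto simp: is_chart_def openin_subset)
  moreover have "inj_on \<phi> (topspace (subtopology (mtop M) V))"
    using assms homeomorphic_imp_injective_map unfolding is_chart_def by blast
  ultimately show ?thesis
    by (simp add: inf.absorb2)
qed

text \<open>Coordinate changes act on tangent vectors by their differentials, so by the chain rule the
  derivatives of \<open>g\<close> in two charts give the same value on a tangent vector.\<close>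

lemma chart_derivatives_agree:
  assumes M: "subspace (model M)" and U: "openin (mtop M) U" "\<theta> \<in> U"
    and c: "(V, \<phi>) \<in> charts_at M \<theta>" and c': "(W, \<psi>) \<in> charts_at M \<theta>"
    and A: "((g \<circ> inv_into V \<phi>) has_derivative A) (at (\<phi> \<theta>) within \<phi> ` (U \<inter> V))"
    and B: "((g \<circ> inv_into W \<psi>) has_derivative B) (at (\<psi> \<theta>) within \<psi> ` (U \<inter> W))"
    and v: "v \<in> tangent_space M \<theta>"
  shows "A (v (V, \<phi>)) = B (v (W, \<psi>))"
proof -
  have charts: "is_chart M (V, \<phi>)" "is_chart M (W, \<psi>)" and \<theta>: "\<theta> \<in> V" "\<theta> \<in> W"
    using c c' by (auto simp: charts_at_def smooth_charts_def)
  have inj: "inj_on \<phi> V" "inj_on \<psi> W"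
    using charts by (auto intro: is_chart_inj_on)
  let ?O = "\<phi> ` (U \<inter> V \<inter> W)"
  let ?h = "\<psi> \<circ> inv_into V \<phi>"
  have opens: "openin (mtop M) (U \<inter> V \<inter> W)"
    using U(1) charts by (auto simp: is_chart_def)
  have O: "openin (top_of_set (model M)) ?O" "\<phi> \<theta> \<in> ?O"
    using is_chart_open_image[OF charts(1) opens] U(2) \<theta> by auto
  obtain C where C: "(?h has_derivative C) (at (\<phi> \<theta>) within \<phi> ` (V \<inter> W))"
    and vC: "v (W, \<psi>) = C (v (V, \<phi>))"
    using v c c' unfolding tangent_space_def by blast
  have inv: "inv_into V \<phi> (\<phi> x) = x" if "x \<in> V" for x
    using inj(1) that by simp
  have "(?h has_derivative C) (at (\<phi> \<theta>) within ?O)"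
    using C by (rule has_derivative_subset) auto
  moreover have "((g \<circ> inv_into W \<psi>) has_derivative B) (at (?h (\<phi> \<theta>)) within ?h ` ?O)"
  proof -
    have "?h (\<phi> \<theta>) = \<psi> \<theta>" and "?h ` ?O \<subseteq> \<psi> ` (U \<inter> W)"
      using \<theta> by (auto simp: inv)
    then show ?thesis
      using has_derivative_subset[OF B] by simp
  qed
  ultimately have "((g \<circ> inv_into W \<psi> \<circ> ?h) has_derivative (B \<circ> C)) (at (\<phi> \<theta>) within ?O)"
    by (rule diff_chain_within)
  \<comment> \<open>The composite is \<open>g\<close> in the chart \<open>\<phi>\<close> only over the overlap \<open>?O\<close>, so derivatives are compared there.\<close>
  moreover have "(g \<circ> inv_into W \<psi> \<circ> ?h) y = (g \<circ> inv_into V \<phi>) y" if "y \<in> ?O" for y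
    using that inj by (auto simp: inv)
  ultimately have "((g \<circ> inv_into V \<phi>) has_derivative (B \<circ> C)) (at (\<phi> \<theta>) within ?O)"
    using O(2) by (auto intro: has_derivative_transform[rotated 2])
  moreover have "((g \<circ> inv_into V \<phi>) has_derivative A) (at (\<phi> \<theta>) within ?O)"
    using A by (rule has_derivative_subset) auto
  moreover have "v (V, \<phi>) \<in> model M"
    using v c by (auto simp: tangent_space_def)
  ultimately have "A (v (V, \<phi>)) = (B \<circ> C) (v (V, \<phi>))"
    using has_derivative_within_unique_on_subspace[OF M O] by blast
  then show ?thesis
    by (simp add: vC)
qed

lemma Ck_map_imp_has_differential:
  assumes M: "subspace (model M)" and U: "openin (mtop M) U" "\<theta> \<in> U"
    and g: "Ck_map M r U g" and r: "r \<ge> 1"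
  shows "\<exists>D. has_differential M g U \<theta> D"
proof (cases "charts_at M \<theta> = {}")
  case True
  then show ?thesis by (simp add: has_differential_def)
next
  case False
  have deriv: "\<exists>A. ((g \<circ> inv_into V \<phi>) has_derivative A) (at (\<phi> \<theta>) within \<phi> ` (U \<inter> V))"
    if "(V, \<phi>) \<in> charts_at M \<theta>" for V \<phi>
  proof -
    obtain r' where "r = Suc r'"
      using r by (cases r) auto
    moreover have "(V, \<phi>) \<in> smooth_charts M" "\<theta> \<in> V"
      using that by (auto simp: charts_at_def)
    ultimately have "Ck_on (Suc r') (model M) (\<phi> ` (U \<inter> V)) (g \<circ> inv_into V \<phi>)"
      using g by (auto simp: Ck_map_def)
    moreover have "\<phi> \<theta> \<in> \<phi> ` (U \<inter> V)"
      using U(2) \<open>\<theta> \<in> V\<close> by blast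
    ultimately show ?thesis
      unfolding Ck_on.simps by blast
  qed
  obtain V0 \<phi>0 where c0: "(V0, \<phi>0) \<in> charts_at M \<theta>"
    using False by auto
  obtain A0 where A0: "((g \<circ> inv_into V0 \<phi>0) has_derivative A0) (at (\<phi>0 \<theta>) within \<phi>0 ` (U \<inter> V0))"
    using deriv[OF c0] by blast
  have "has_differential M g U \<theta> (\<lambda>v. A0 (v (V0, \<phi>0)))"
    unfolding has_differential_def
    using deriv chart_derivatives_agree[OF M U c0 _ A0] by blast
  then show ?thesis by blast
qed

lemma Ck_pair_imp_has_differential_pair:
  assumes "subspace (model M)" and "openin (mtop M) U" "\<theta> \<in> U"
    and G: "Ck_pair M r U m n G" and "r \<ge> 1"
  shows "\<exists>D. has_differential_pair M m n G U \<theta> D"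
proof -
  note exD = Ck_map_imp_has_differential[OF assms(1-3) _ \<open>r \<ge> 1\<close>]
  have "\<forall>i. \<exists>D. i < 2 * m \<longrightarrow> has_differential M (\<lambda>x. vec_index (fst (G x)) i) U \<theta> D"
    using G exD by (auto simp: Ck_pair_def)
  then obtain D1 where D1:
    "\<And>i. i < 2 * m \<Longrightarrow> has_differential M (\<lambda>x. vec_index (fst (G x)) i) U \<theta> (D1 i)"
    by metis
  have "\<forall>j. \<exists>D. j < n \<longrightarrow> has_differential M (\<lambda>x. vec_index (snd (G x)) j) U \<theta> D"
    using G exD by (auto simp: Ck_pair_def)
  then obtain D2 where D2:
    "\<And>j. j < n \<Longrightarrow> has_differential M (\<lambda>x. vec_index (snd (G x)) j) U \<theta> (D2 j)"
    by metis
  have "has_differential_pair M m n G U \<theta> (\<lambda>v. (vec (2 * m) (\<lambda>i. D1 i v), vec n (\<lambda>j. D2 j v)))"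
    unfolding has_differential_pair_def using D1 D2 by auto
  then show ?thesis by blast
qed

section \<open>Local lifts from extensions\<close>

text \<open>The components of a block of an extension are components of the extension, and on the
  stratum, where the extension agrees with \<open>H\<close>, the block maps to the barcode.\<close>

lemma local_extension_imp_local_lift:
  assumes ext: "local_extension M r N H S \<theta> U G"
    and N: "(\<Sum>q\<le>d. 2 * m q + n q) = N" and p: "p \<le> d"
    and lift: "\<And>x. x \<in> S \<Longrightarrow> Q (m p) (n p) (block m n p (H x)) = B x"
  shows "local_lift_along M r B \<theta> S U (m p) (n p) (\<lambda>x. block m n p (G x))"
proof -
  have "(\<Sum>q<p. 2 * m q + n q) + (2 * m p + n p) = (\<Sum>q\<le>p. 2 * m q + n q)"
    by (simp add: lessThan_Suc_atMost[symmetric])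
  also have "\<dots> \<le> N"
    unfolding N[symmetric] using p by (intro sum_mono2) auto
  finally have fits: "(\<Sum>q<p. 2 * m q + n q) + (2 * m p + n p) \<le> N" .
  have "Ck_pair M r U (m p) (n p) (\<lambda>x. block m n p (G x))"
    using ext fits by (auto simp: Ck_pair_def block_def Let_def local_extension_def)
  moreover have "B x = Q (m p) (n p) (block m n p (G x))" if "x \<in> U \<inter> S" for x
    using ext lift that by (auto simp: local_extension_def)
  ultimately show ?thesis
    using ext by (auto simp: local_lift_along_def local_extension_def)
qed

text \<open>Every coordinate of the permuted extension is some \<open>x \<mapsto> G x \<sigma>\<close> on the whole of \<open>U\<close>, not only on
  the stratum, and so it is of class \<open>C\<^sup>r\<close>.\<close>

lemma local_extension_permute_coords:
  assumes P: "permutation_matrix (length ks) P"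
    and U: "openin (mtop M) U" "\<theta> \<in> U"
    and G: "\<And>\<sigma>. \<sigma> \<in> set ks \<Longrightarrow> Ck_map M r U (\<lambda>x. G x \<sigma>)"
    and GF: "\<And>x \<sigma>. x \<in> S \<inter> U \<Longrightarrow> \<sigma> \<in> set ks \<Longrightarrow> G x \<sigma> = F x \<sigma>"
    and H: "\<And>x. x \<in> S \<Longrightarrow> H x = P *\<^sub>v coords ks (F x)"
  shows "local_extension M r (length ks) H S \<theta> U (\<lambda>x. P *\<^sub>v coords ks (G x))"
proof -
  obtain \<pi> where \<pi>: "\<And>i. i < length ks \<Longrightarrow> \<pi> i < length ks"
    and sel: "\<And>x i. x \<in> carrier_vec (length ks) \<Longrightarrow> i < length ks
      \<Longrightarrow> vec_index (P *\<^sub>v x) i = vec_index x (\<pi> i)"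
    using permutation_matrix_selects[OF P] by blast
  have carrier: "coords ks f \<in> carrier_vec (length ks)" for f
    by (rule carrier_vecI) (simp add: coords_def)
  have "vec_index (P *\<^sub>v coords ks f) i = f (ks ! \<pi> i)" if "i < length ks" for f i
    using sel[OF carrier that] \<pi>[OF that] by (simp add: coords_def vec_of_list_index)
  then have smooth: "Ck_map M r U (\<lambda>x. vec_index (P *\<^sub>v coords ks (G x)) i)"
    if "i < length ks" for i
    using G \<pi>[OF that] that by simp
  have "coords ks (G x) = coords ks (F x)" if "x \<in> S \<inter> U" for x
    using GF[OF that] by (simp add: coords_def cong: map_cong)
  then have "P *\<^sub>v coords ks (G x) = H x" if "x \<in> S \<inter> U" for x
    using H that by simp
  moreover have "P *\<^sub>v coords ks (G x) \<in> carrier_vec (length ks)" for x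
    using P by (auto simp: permutation_matrix_def intro!: mult_mat_vec_carrier carrier)
  ultimately show ?thesis
    using U smooth by (auto simp: local_extension_def)
qed

section \<open>The global lift of a parametrised family of barcodes\<close>

theorem corollary4p24:
  fixes K :: "'v set set" and ks :: "'v set list" and d :: nat
    and M :: "('a, 'e::euclidean_space) manifold"
    and F :: "'a \<Rightarrow> 'v set \<Rightarrow> real"
    and m n :: "nat \<Rightarrow> nat"
    and Perm :: "('v set \<Rightarrow> real) \<Rightarrow> real vec"
    and B :: "'a \<Rightarrow> nat \<Rightarrow> barcode"
    and Bt :: "'a \<Rightarrow> real vec"
  assumes "simplicial_complex K" and "finite K" and "K \<noteq> {}" and "complex_dim K = d"
    and "distinct ks" and "set ks = K"
    and "smooth_manifold M"
    and "\<forall>\<theta>\<in>topspace (mtop M). filter_function K (F \<theta>)"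
    and "permutation_data TYPE('k::field) K ks d m n Perm"
  defines "B \<equiv> \<lambda>\<theta> p. Dgm TYPE('k) K (F \<theta>) p"
    and "Bt \<equiv> \<lambda>\<theta>. Perm (F \<theta>)"
  shows "(\<forall>\<theta>\<in>topspace (mtop M). \<forall>p\<le>d. Q (m p) (n p) (block m n p (Bt \<theta>)) = B \<theta> p)
    \<and> (\<forall>r \<S>.
        whitney_stratification M \<S>
        \<and> weakly_stratified (topspace (mtop M)) \<S> (Omega K) F
        \<and> (\<forall>S\<in>\<S>. \<forall>\<sigma>\<in>K. Ck_on_submanifold M r S (\<lambda>\<theta>. F \<theta> \<sigma>))
        \<and> (\<forall>\<theta>\<in>topspace (mtop M). \<forall>S\<in>\<S>. incident M S \<theta> \<longrightarrow>
             (\<exists>U G. openin (mtop M) U \<and> \<theta> \<in> U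
                \<and> (\<forall>\<sigma>\<in>K. Ck_map M r U (\<lambda>x. G x \<sigma>))
                \<and> (\<forall>x\<in>S \<inter> U. \<forall>\<sigma>\<in>K. G x \<sigma> = F x \<sigma>)))
        \<longrightarrow>
        (\<forall>S\<in>\<S>. \<exists>P. permutation_matrix (card K) P \<and> (\<forall>\<theta>\<in>S. Bt \<theta> = P *\<^sub>v coords ks (F \<theta>)))
        \<and> (\<forall>\<theta>\<in>topspace (mtop M). \<forall>S\<in>\<S>. incident M S \<theta> \<longrightarrow>
             (\<forall>p\<le>d. differentiable_along M r (\<lambda>x. B x p) \<theta> S)
             \<and> (\<exists>U G. local_extension M r (card K) Bt S \<theta> U G)
             \<and> (\<forall>U G. local_extension M r (card K) Bt S \<theta> U G \<longrightarrow>
                  (\<forall>p\<le>d.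
                     (r \<ge> 1 \<longrightarrow> (\<exists>D. has_differential_pair M (m p) (n p) (\<lambda>x. block m n p (G x)) U \<theta> D))
                     \<and> (\<forall>D. has_differential_pair M (m p) (n p) (\<lambda>x. block m n p (G x)) U \<theta> D
                          \<longrightarrow> directional_derivative M r (\<lambda>x. B x p) \<theta> S (m p) (n p) D)))))"
proof -
  have N: "(\<Sum>p\<le>d. 2 * m p + n p) = card K"
    and perm: "\<And>T. T \<in> Omega K \<Longrightarrow>
      \<exists>P. permutation_matrix (card K) P \<and> (\<forall>f\<in>T. Perm f = P *\<^sub>v coords ks f)"
    and Perm_lifts: "\<And>f p. filter_function K f \<Longrightarrow> p \<le> d \<Longrightarrow>
      Q (m p) (n p) (block m n p (Perm f)) = Dgm TYPE('k) K f p"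
    using assms(9) by (auto simp: permutation_data_def)
  have len: "length ks = card K"
    using distinct_card[OF assms(5)] assms(6) by simp
  have sub: "subspace (model M)"
    using assms(7) unfolding smooth_manifold_def by (rule conjunct1)
  have lift: "Q (m p) (n p) (block m n p (Bt \<theta>)) = B \<theta> p"
    if "\<theta> \<in> topspace (mtop M)" "p \<le> d" for \<theta> p
    using Perm_lifts assms(8) that by (simp add: B_def Bt_def)
  have matrix: "\<exists>P. permutation_matrix (card K) P \<and> (\<forall>\<theta>\<in>S. Bt \<theta> = P *\<^sub>v coords ks (F \<theta>))"
    if strat: "whitney_stratification M \<S>" "weakly_stratified (topspace (mtop M)) \<S> (Omega K) F"
      and "S \<in> \<S>" for \<S> S
  proof -
    have "partition_on (topspace (mtop M)) \<S>"
      using strat(1) by (simp add: whitney_stratification_def)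
    moreover have "\<And>\<theta>. \<theta> \<in> topspace (mtop M) \<Longrightarrow> F \<theta> \<in> fun_space K"
      using assms(8) by (auto simp: filter_function_def)
    ultimately obtain T where "T \<in> Omega K" "F ` S \<subseteq> T"
      using stratum_into_ordering_class strat(2) \<open>S \<in> \<S>\<close> by metis
    then show ?thesis
      using perm unfolding Bt_def by blast
  qed
  have local_lift: "local_lift_along M r (\<lambda>x. B x p) \<theta> S U (m p) (n p) (\<lambda>x. block m n p (G x))"
    if "S \<subseteq> topspace (mtop M)" "local_extension M r (card K) Bt S \<theta> U G" "p \<le> d" for r S \<theta> U G p
  proof (rule local_extension_imp_local_lift[OF that(2) N that(3)])
    show "Q (m p) (n p) (block m n p (Bt x)) = B x p" if "x \<in> S" for x
      using lift[OF subsetD[OF \<open>S \<subseteq> topspace (mtop M)\<close> that] \<open>p \<le> d\<close>] .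
  qed
  have extension: "\<exists>U G. local_extension M r (card K) Bt S \<theta> U G"
    if P: "permutation_matrix (card K) P" "\<forall>\<theta>\<in>S. Bt \<theta> = P *\<^sub>v coords ks (F \<theta>)"
      and ext: "\<exists>U G. openin (mtop M) U \<and> \<theta> \<in> U \<and> (\<forall>\<sigma>\<in>K. Ck_map M r U (\<lambda>x. G x \<sigma>))
        \<and> (\<forall>x\<in>S \<inter> U. \<forall>\<sigma>\<in>K. G x \<sigma> = F x \<sigma>)" for r S \<theta> P
  proof -
    obtain U G where U: "openin (mtop M) U" "\<theta> \<in> U"
      and "\<forall>\<sigma>\<in>K. Ck_map M r U (\<lambda>x. G x \<sigma>)" "\<forall>x\<in>S \<inter> U. \<forall>\<sigma>\<in>K. G x \<sigma> = F x \<sigma>"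
      using ext by blast
    then have "local_extension M r (card K) Bt S \<theta> U (\<lambda>x. P *\<^sub>v coords ks (G x))"
      using local_extension_permute_coords[of ks P M U \<theta> r G S F Bt] P assms(6) len
      by simp
    then show ?thesis by blast
  qed
  show ?thesis
  proof (intro conjI allI impI ballI; (elim conjE)?)
    fix \<theta> p assume "\<theta> \<in> topspace (mtop M)" "p \<le> d"
    then show "Q (m p) (n p) (block m n p (Bt \<theta>)) = B \<theta> p" by (rule lift)
  next
    fix \<S> S
    assume "whitney_stratification M \<S>" "weakly_stratified (topspace (mtop M)) \<S> (Omega K) F"
      "S \<in> \<S>"
    then show "\<exists>P. permutation_matrix (card K) P \<and> (\<forall>\<theta>\<in>S. Bt \<theta> = P *\<^sub>v coords ks (F \<theta>))"
      by (rule matrix)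
  next
    fix r \<S> \<theta> S
    assume strat: "whitney_stratification M \<S>"
        "weakly_stratified (topspace (mtop M)) \<S> (Omega K) F"
      and ext: "\<forall>\<theta>\<in>topspace (mtop M). \<forall>S\<in>\<S>. incident M S \<theta> \<longrightarrow>
             (\<exists>U G. openin (mtop M) U \<and> \<theta> \<in> U
                \<and> (\<forall>\<sigma>\<in>K. Ck_map M r U (\<lambda>x. G x \<sigma>))
                \<and> (\<forall>x\<in>S \<inter> U. \<forall>\<sigma>\<in>K. G x \<sigma> = F x \<sigma>))"
      and \<theta>: "\<theta> \<in> topspace (mtop M)" and S: "S \<in> \<S>" and inc: "incident M S \<theta>"
    have S_sub: "S \<subseteq> topspace (mtop M)"
      using strat(1) S by (auto simp: whitney_stratification_def submanifold_def)
    obtain P where P: "permutation_matrix (card K) P" "\<forall>\<theta>\<in>S. Bt \<theta> = P *\<^sub>v coords ks (F \<theta>)"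
      using matrix[OF strat S] by (elim exE conjE)
    have ex: "\<exists>U G. local_extension M r (card K) Bt S \<theta> U G"
      by (rule extension[OF P ext[THEN bspec, OF \<theta>, THEN bspec, OF S, THEN mp, OF inc]])
    then show "\<exists>U G. local_extension M r (card K) Bt S \<theta> U G" .
    show "differentiable_along M r (\<lambda>x. B x p) \<theta> S" if "p \<le> d" for p
      using ex local_lift[OF S_sub _ that] unfolding differentiable_along_def by blast
    fix U G p
    assume "local_extension M r (card K) Bt S \<theta> U G" "p \<le> d"
    then have l: "local_lift_along M r (\<lambda>x. B x p) \<theta> S U (m p) (n p) (\<lambda>x. block m n p (G x))"
      by (rule local_lift[OF S_sub])
    show "\<exists>D. has_differential_pair M (m p) (n p) (\<lambda>x. block m n p (G x)) U \<theta> D" if "1 \<le> r"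
      using l that Ck_pair_imp_has_differential_pair[OF sub] unfolding local_lift_along_def by blast
    show "directional_derivative M r (\<lambda>x. B x p) \<theta> S (m p) (n p) D"
      if "has_differential_pair M (m p) (n p) (\<lambda>x. block m n p (G x)) U \<theta> D" for D
      using l that unfolding directional_derivative_def by blast
  qed
qed

end
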